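(* Let $G:\mathbb R^n\to\mathbb R^m$ be continuously differentiable, let $C:=\{0\}\subset\mathbb R^m$, let $D\subset\mathbb R^n$ be nonempty, closed and convex, and let $\bar x\in D$ satisfy $G(\bar x)=0$. Suppose that the following constraint qualification holds at $\bar x$: there exist $r>0$ and $\tau>0$ such that, with $\mathcal E:=\operatorname{aff}(D)-\bar x$, (a) for every $y\in\operatorname{aff}(D)$ with $\|y-\bar x\|\le\tau$, $\dim(\{\nabla G(y)d: d\in\mathcal E\})=r$; (b) for every $y\in D$ with $\|y-\bar x\|\le\tau$, $\dim(\{\nabla G(y)d: d\in\operatorname{lin}(\mathcal T_D(y))\})=r$. Then $\bar x$ is AM-regular.
   Context: $\nabla G(x)\in\mathbb R^{m\times n}$ is the Jacobian. $\operatorname{aff}(D)$ is the affine hull of $D$. $\mathcal T_D(y)$ is the tangent (Bouligand) cone: $\{w:\exists y^k\to y,\ y^k\in D,\ \tau^k\downarrow0,\ (y^k-y)/\tau^k\to w\}$, and $\operatorname{lin}(\mathcal T_D(y)):=\mathcal T_D(y)\cap(-\mathcal T_D(y))$. For a convex set $S$, $\mathcal N_S(z):=\{v:\langle v,x-z\rangle\le0\ \forall x\in S\}$ if $z\in S$ and $\mathcal N_S(z):=\emptyset$ if $z\notin S$ (for convex $S$ the limiting normal cone coincides with $\mathcal N_S$). AM-regularity: $\bar x$ with $\bar x\in D$, $G(\bar x)\in C$ is AM-regular if $\limsup_{x\to\bar x,\,z\to0}\mathcal M(x,z)\subset\mathcal M(\bar x,0)$, where $\mathcal M(x,z):=\nabla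 G(x)^T\mathcal N_C(G(x)-z)+\mathcal N_D(x)$ and $\limsup$ is the Painlevé–Kuratowski outer limit (all limits of sequences $\xi^k\in\mathcal M(x^k,z^k)$ with $x^k\to\bar x$, $z^k\to0$). For $C=\{0\}$ this reduces to $\limsup_{x\to\bar x}\mathcal K(x)\subset\mathcal K(\bar x)$ with $\mathcal K(x):=\operatorname{Range}(\nabla G(x)^T)+\mathcal N_D(x)$. *)

theory Defs
  imports "HOL-Analysis.Analysis"
begin

abbreviation Jac :: "(real^'n \<Rightarrow> real^'m) \<Rightarrow> real^'n \<Rightarrow> real^'n^'m" where
  "Jac G x \<equiv> jacobian G (at x)"

definition continuously_differentiable :: "(real^'n \<Rightarrow> real^'m) \<Rightarrow> bool" where
  "continuously_differentiable G \<longleftrightarrow>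
     (\<forall>x. G differentiable (at x)) \<and> continuous_on UNIV (Jac G)"

text \<open>Here \<open>\<tau>\<^sup>k \<down> 0\<close> is read as: positive and converging to \<open>0\<close>.\<close>

definition tangent_cone :: "(real^'n) set \<Rightarrow> real^'n \<Rightarrow> (real^'n) set" where
  "tangent_cone D y =
     {w. \<exists>(u :: nat \<Rightarrow> real^'n) (t :: nat \<Rightarrow> real).
           u \<longlonglongrightarrow> y \<and> (\<forall>k. u k \<in> D) \<and> (\<forall>k. 0 < t k) \<and> t \<longlonglongrightarrow> 0 \<and>
           (\<lambda>k. (u k - y) /\<^sub>R t k) \<longlonglongrightarrow> w}"

definition lin_tangent :: "(real^'n) set \<Rightarrow> real^'n \<Rightarrow> (real^'n) set" where
  "lin_tangent D y = tangent_cone D y \<inter> uminus ` tangent_cone D y"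

text \<open>The normal cone of convex analysis. It agrees with the limiting normal cone
  only for convex \<open>S\<close>, so everything below is meant for convex \<open>C\<close> and \<open>D\<close>.\<close>

definition normal_cone :: "(real^'n) set \<Rightarrow> real^'n \<Rightarrow> (real^'n) set" where
  "normal_cone S z = (if z \<in> S then {v. \<forall>x\<in>S. v \<bullet> (x - z) \<le> 0} else {})"

definition AM_map ::
    "(real^'n \<Rightarrow> real^'m) \<Rightarrow> (real^'m) set \<Rightarrow> (real^'n) set \<Rightarrow>
     real^'n \<Rightarrow> real^'m \<Rightarrow> (real^'n) set" where
  "AM_map G C D x z =
     {transpose (Jac G x) *v l + v | l v. l \<in> normal_cone C (G x - z) \<and> v \<in> normal_cone D x}"

text \<open>Painleve--Kuratowski outer limit of a set-valued map of two variables. The point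
  \<open>(x\<^sub>0, z\<^sub>0)\<close> is not excluded from the approximating sequences.\<close>

definition outer_limit ::
    "(real^'n \<Rightarrow> real^'m \<Rightarrow> (real^'n) set) \<Rightarrow> real^'n \<Rightarrow> real^'m \<Rightarrow> (real^'n) set" where
  "outer_limit M x0 z0 =
     {\<xi>. \<exists>(x :: nat \<Rightarrow> real^'n) (z :: nat \<Rightarrow> real^'m) (s :: nat \<Rightarrow> real^'n).
           x \<longlonglongrightarrow> x0 \<and> z \<longlonglongrightarrow> z0 \<and> (\<forall>k. s k \<in> M (x k) (z k)) \<and> s \<longlonglongrightarrow> \<xi>}"

definition AM_regular ::
    "(real^'n \<Rightarrow> real^'m) \<Rightarrow> (real^'m) set \<Rightarrow> (real^'n) set \<Rightarrow> real^'n \<Rightarrow> bool" where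
  "AM_regular G C D xbar \<longleftrightarrow>
     xbar \<in> D \<and> G xbar \<in> C \<and> outer_limit (AM_map G C D) xbar 0 \<subseteq> AM_map G C D xbar 0"

end

theory Submission
  imports Defs
begin

text \<open>
  Put \<open>E = aff D - xbar\<close>, and for a matrix \<open>A\<close> let \<open>R(A)\<close> be the orthogonal complement in \<open>E\<close> of
  \<open>E \<inter> ker A\<close>; this is the row space of the restriction of \<open>A\<close> to \<open>E\<close>. A normal cone of \<open>D\<close>
  absorbs \<open>E\<^sup>\<bottom>\<close>, and \<open>Range A\<^sup>T + E\<^sup>\<bottom> = R(A) + E\<^sup>\<bottom>\<close>, so at a point \<open>x\<close> of \<open>D\<close> with Jacobian \<open>A\<close>
  the set \<open>Range A\<^sup>T + N\<^sub>D(x)\<close> equals \<open>R(A) + N\<^sub>D(x)\<close>. The two summands of the new form behave well: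

  \<^item> Both have a closed graph at \<open>xbar\<close>, along points of \<open>D\<close>. For \<open>N\<^sub>D\<close> this is immediate; for \<open>R\<close> it is what the
    constant rank of the Jacobian on \<open>E\<close> gives (\<open>restricted_row_space_limit\<close>).

  \<^item> At \<open>xbar\<close> they meet transversally, \<open>R(A) \<inter> -N\<^sub>D(xbar) = {0}\<close>
    (\<open>restricted_row_space_Int_normal_cone\<close>). An element of the intersection is orthogonal to
    \<open>E \<inter> ker A\<close> and, being normal, also to \<open>lin T\<^sub>D(xbar)\<close>; the rank condition at \<open>xbar\<close> says
    that \<open>A\<close> maps the span of \<open>lin T\<^sub>D(xbar)\<close> onto \<open>A E\<close>, so these two sets together span \<open>E\<close>.

  Transversality prevents the two summands of a convergent sequence in \<open>R(A\<^sub>k) + N\<^sub>D(x\<^sub>k)\<close> from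
  cancelling at infinity, so the limit is again such a sum (\<open>limit_of_sum_of_transversal_cones\<close>).
\<close>

section \<open>Limits of sums of transversal cones\<close>

text \<open>If the summands \<open>w k\<close> were unbounded, dividing by their norms would produce a nonzero
  element of \<open>W0\<close> whose negative lies in \<open>N0\<close>. Dividing by \<open>1 + norm (w k)\<close> instead treats
  the bounded and the unbounded case at once.\<close>

lemma limit_of_sum_of_transversal_cones:
  fixes W N :: "nat \<Rightarrow> 'a::euclidean_space set"
  assumes coneW: "\<And>k. cone (W k)" and coneN: "\<And>k. cone (N k)"
    and coneW0: "cone W0" and coneN0: "cone N0"
    and limW: "\<And>\<phi> u l. \<lbrakk>strict_mono \<phi>; \<And>k. u k \<in> W (\<phi> k); u \<longlonglongrightarrow> l\<rbrakk> \<Longrightarrow> l \<in> W0"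
    and limN: "\<And>\<phi> u l. \<lbrakk>strict_mono \<phi>; \<And>k. u k \<in> N (\<phi> k); u \<longlonglongrightarrow> l\<rbrakk> \<Longrightarrow> l \<in> N0"
    and transversal: "\<And>u. u \<in> W0 \<Longrightarrow> - u \<in> N0 \<Longrightarrow> u = 0"
    and w: "\<And>k. w k \<in> W k" and v: "\<And>k. v k \<in> N k"
    and sum_lim: "(\<lambda>k. w k + v k) \<longlonglongrightarrow> \<xi>"
  obtains w0 v0 where "w0 \<in> W0" "v0 \<in> N0" "\<xi> = w0 + v0"
proof -
  define a where "a k = 1 / (1 + norm (w k))" for k
  have pos: "0 < 1 + norm (w k)" for k
    by (rule add_pos_nonneg) auto
  have a_nonneg: "0 \<le> a k" and a_le: "a k \<le> 1" for k
    unfolding a_def using pos[of k] by auto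
  have a_norm: "norm (a k *\<^sub>R w k) + a k = 1" for k
    unfolding a_def using pos[of k] by (simp add: field_simps)
  have "(a k *\<^sub>R w k, a k) \<in> cball 0 1 \<times> {0..1}" for k
    using a_norm[of k] a_nonneg[of k] a_le[of k] by auto
  moreover have "compact (cball (0::'a) 1 \<times> {0..1::real})"
    by (intro compact_Times) auto
  ultimately obtain p \<phi> where \<phi>: "strict_mono \<phi>"
    and p: "((\<lambda>k. (a k *\<^sub>R w k, a k)) \<circ> \<phi>) \<longlonglongrightarrow> p"
    unfolding compact_def by meson
  obtain u b where pub: "p = (u, b)"
    by (cases p)
  have u: "(\<lambda>k. a (\<phi> k) *\<^sub>R w (\<phi> k)) \<longlonglongrightarrow> u" and b: "(\<lambda>k. a (\<phi> k)) \<longlonglongrightarrow> b"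
    using tendsto_fst[OF p] tendsto_snd[OF p] by (simp_all add: pub o_def)
  have "(\<lambda>k. norm (a (\<phi> k) *\<^sub>R w (\<phi> k)) + a (\<phi> k)) \<longlonglongrightarrow> norm u + b"
    by (intro tendsto_intros u b)
  hence ub: "norm u + b = 1"
    unfolding a_norm by (simp add: tendsto_const_iff)
  have b_nonneg: "0 \<le> b"
    using b a_nonneg by (auto intro: LIMSEQ_le_const)
  have uW: "u \<in> W0"
    using \<phi> _ u by (rule limW) (use coneW w a_nonneg in \<open>auto simp: cone_def\<close>)
  have "(\<lambda>k. a (\<phi> k) *\<^sub>R (w (\<phi> k) + v (\<phi> k)) - a (\<phi> k) *\<^sub>R w (\<phi> k)) \<longlonglongrightarrow> b *\<^sub>R \<xi> - u"
    using LIMSEQ_subseq_LIMSEQ[OF sum_lim \<phi>] by (intro tendsto_intros u b) (simp add: o_def)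
  hence "(\<lambda>k. a (\<phi> k) *\<^sub>R v (\<phi> k)) \<longlonglongrightarrow> b *\<^sub>R \<xi> - u"
    by (simp add: algebra_simps)
  with \<phi> _ have vN: "b *\<^sub>R \<xi> - u \<in> N0"
    by (rule limN) (use coneN v a_nonneg in \<open>auto simp: cone_def\<close>)
  have "b \<noteq> 0"
    using transversal[OF uW] vN ub by auto
  with b_nonneg have "0 < b"
    by simp
  show thesis
  proof (rule that)
    show "(1 / b) *\<^sub>R u \<in> W0"
      using coneW0 uW \<open>0 < b\<close> by (simp add: cone_def)
    show "(1 / b) *\<^sub>R (b *\<^sub>R \<xi> - u) \<in> N0"
      using coneN0 vN \<open>0 < b\<close> by (simp add: cone_def)
    show "\<xi> = (1 / b) *\<^sub>R u + (1 / b) *\<^sub>R (b *\<^sub>R \<xi> - u)"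
      using \<open>0 < b\<close> by (simp add: algebra_simps)
  qed
qed

section \<open>The row space of a matrix restricted to a subspace\<close>

definition restricted_row_space :: "(real^'n) set \<Rightarrow> real^'n^'m \<Rightarrow> (real^'n) set" where
  "restricted_row_space E A = E \<inter> (E \<inter> {d. A *v d = 0})\<^sup>\<bottom>"

lemma restricted_row_space_iff:
  "w \<in> restricted_row_space E A \<longleftrightarrow> w \<in> E \<and> (\<forall>d\<in>E. A *v d = 0 \<longrightarrow> w \<bullet> d = 0)"
  by (auto simp: restricted_row_space_def orthogonal_comp_def orthogonal_def inner_commute)

lemma subspace_restricted_row_space:
  "subspace E \<Longrightarrow> subspace (restricted_row_space E A)"
  unfolding restricted_row_space_def by (intro subspace_inter subspace_orthogonal_comp)

lemma orthogonal_decomposition: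
  fixes U :: "'a::euclidean_space set"
  assumes "subspace U"
  obtains y z where "y \<in> U" "z \<in> U\<^sup>\<bottom>" "x = y + z"
  using subspace_sum_orthogonal_comp[OF assms] set_plus_elim by blast

text \<open>Both sides are the orthogonal complement of \<open>E \<inter> ker A\<close>: a vector orthogonal to the
  right-hand side lies in \<open>E\<^sup>\<bottom>\<^sup>\<bottom> = E\<close> and in \<open>(Range A\<^sup>T)\<^sup>\<bottom> = ker A\<close>.\<close>

lemma set_plus_eq:
  fixes S T :: "'a::plus set"
  shows "S + T = {x + y |x y. x \<in> S \<and> y \<in> T}"
  by (auto simp: set_plus_def)

lemma restricted_row_space_plus_orthogonal_comp:
  fixes A :: "real^'n^'m"
  assumes E: "subspace E"
  shows "restricted_row_space E A + E\<^sup>\<bottom> = range ((*v) (transpose A)) + E\<^sup>\<bottom>"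
proof -
  let ?K = "E \<inter> {d. A *v d = 0}" and ?S = "range ((*v) (transpose A)) + E\<^sup>\<bottom>"
  have EK: "E\<^sup>\<bottom> \<subseteq> ?K\<^sup>\<bottom>"
    by (rule orthogonal_comp_anti_mono) auto
  have K: "subspace (?K\<^sup>\<bottom>)"
    by (rule subspace_orthogonal_comp)
  have "restricted_row_space E A + E\<^sup>\<bottom> = ?K\<^sup>\<bottom>"
  proof
    show "restricted_row_space E A + E\<^sup>\<bottom> \<subseteq> ?K\<^sup>\<bottom>"
      using EK K by (auto simp: restricted_row_space_def set_plus_def intro: subspace_add)
    show "?K\<^sup>\<bottom> \<subseteq> restricted_row_space E A + E\<^sup>\<bottom>"
    proof
      fix x assume x: "x \<in> ?K\<^sup>\<bottom>"
      obtain y z where yz: "y \<in> E" "z \<in> E\<^sup>\<bottom>" "x = y + z"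
        using orthogonal_decomposition[OF E] .
      have "y = x - z"
        using yz by simp
      hence "y \<in> ?K\<^sup>\<bottom>"
        using x yz(2) EK K subspace_diff by blast
      with yz show "x \<in> restricted_row_space E A + E\<^sup>\<bottom>"
        by (auto simp: restricted_row_space_def)
    qed
  qed
  moreover have "?S = ?K\<^sup>\<bottom>"
  proof
    show "?S \<subseteq> ?K\<^sup>\<bottom>"
    proof
      fix x assume "x \<in> ?S"
      then obtain l u where lu: "x = transpose A *v l + u" "u \<in> E\<^sup>\<bottom>"
        by (auto elim: set_plus_elim)
      have "transpose A *v l \<in> ?K\<^sup>\<bottom>"
        by (auto simp: orthogonal_comp_def orthogonal_def inner_commute[of _ "l v* A"] dot_lmul_matrix)
      with lu EK K show "x \<in> ?K\<^sup>\<bottom>"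
        by (auto intro: subspace_add)
    qed
    have "subspace (range ((*v) (transpose A)))"
      by (intro linear_subspace_image matrix_vector_mul_linear subspace_UNIV)
    hence S: "subspace ?S"
      using subspace_sums[OF _ subspace_orthogonal_comp[of E]] by (simp add: set_plus_eq)
    have "?S\<^sup>\<bottom> \<subseteq> ?K"
    proof
      fix q assume q: "q \<in> ?S\<^sup>\<bottom>"
      have *: "(transpose A *v l + u) \<bullet> q = 0" if "u \<in> E\<^sup>\<bottom>" for l u
        using q that by (auto simp: orthogonal_comp_def orthogonal_def)
      have "u \<bullet> q = 0" if "u \<in> E\<^sup>\<bottom>" for u
        using *[OF that, of 0] by simp
      hence "q \<in> (E\<^sup>\<bottom>)\<^sup>\<bottom>"
        by (simp add: orthogonal_comp_def[of "E\<^sup>\<bottom>"] orthogonal_def)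
      moreover have "l \<bullet> (A *v q) = 0" for l
        using *[of 0 l] subspace_0[OF subspace_orthogonal_comp[of E]]
        by (simp add: dot_lmul_matrix)
      hence "A *v q = 0"
        by (metis inner_eq_zero_iff)
      ultimately show "q \<in> ?K"
        by (simp add: orthogonal_comp_self E)
    qed
    hence "?K\<^sup>\<bottom> \<subseteq> (?S\<^sup>\<bottom>)\<^sup>\<bottom>"
      by (rule orthogonal_comp_anti_mono)
    thus "?K\<^sup>\<bottom> \<subseteq> ?S"
      by (simp only: orthogonal_comp_self[OF S])
  qed
  ultimately show ?thesis
    by simp
qed

lemma inj_on_restricted_row_space:
  assumes "subspace E"
  shows "inj_on ((*v) A) (restricted_row_space E A)"
proof (rule inj_onI)
  fix x y assume xy: "x \<in> restricted_row_space E A" "y \<in> restricted_row_space E A" "A *v x = A *v y"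
  have d: "x - y \<in> restricted_row_space E A"
    using xy subspace_restricted_row_space[OF assms] by (blast intro: subspace_diff)
  have "A *v (x - y) = 0"
    using xy(3) by (simp add: matrix_vector_mult_diff_distrib)
  with d have "(x - y) \<bullet> (x - y) = 0"
    unfolding restricted_row_space_iff by blast
  thus "x = y"
    by simp
qed

lemma image_restricted_row_space:
  assumes "subspace E"
  shows "(*v) A ` restricted_row_space E A = (*v) A ` E"
proof
  show "(*v) A ` restricted_row_space E A \<subseteq> (*v) A ` E"
    by (auto simp: restricted_row_space_def)
  have K: "subspace (E \<inter> {d. A *v d = 0})"
    by (intro subspace_inter assms linear_subspace_kernel matrix_vector_mul_linear)
  show "(*v) A ` E \<subseteq> (*v) A ` restricted_row_space E A"
  proof clarify
    fix e assume e: "e \<in> E"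
    obtain y z where yz: "y \<in> E \<inter> {d. A *v d = 0}" "z \<in> (E \<inter> {d. A *v d = 0})\<^sup>\<bottom>" "e = y + z"
      using orthogonal_decomposition[OF K] .
    have "z = e - y"
      using yz by simp
    hence "z \<in> E"
      using yz(1) e subspace_diff[OF assms] by simp
    with yz(2) have "z \<in> restricted_row_space E A"
      by (simp add: restricted_row_space_def)
    moreover have "A *v e = A *v z"
      using yz by (simp add: matrix_vector_right_distrib)
    ultimately show "A *v e \<in> (*v) A ` restricted_row_space E A"
      by blast
  qed
qed

lemma tendsto_matrix_vector_mult:
  fixes A :: "nat \<Rightarrow> real^'n^'m"
  assumes "A \<longlonglongrightarrow> B"
  shows "(\<lambda>k. A k *v x) \<longlonglongrightarrow> B *v x"
  unfolding matrix_vector_mult_def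
  by (intro tendsto_intros tendsto_vec_lambda tendsto_vec_nth assms)

text \<open>The bound \<open>norm (A *v f) \<ge> c * norm f\<close> that injectivity provides on a fixed subspace
  survives a small perturbation of the matrix.\<close>

lemma eventually_norm_mult_ge:
  fixes A :: "nat \<Rightarrow> real^'n^'m"
  assumes F: "subspace F" and inj: "inj_on ((*v) B) F" and A: "A \<longlonglongrightarrow> B"
  obtains c where "0 < c" "\<forall>\<^sub>F k in sequentially. \<forall>f\<in>F. c * norm f \<le> norm (A k *v f)"
proof -
  have "\<forall>f\<in>F. B *v f = 0 \<longrightarrow> f = 0"
    using inj subspace_0[OF F] by (metis inj_onD matrix_vector_mult_0_right)
  then obtain e where e: "0 < e" "\<forall>f\<in>F. e * norm f \<le> norm (B *v f)"
    using injective_imp_isometric[OF closed_subspace[OF F] F matrix_vector_mul_bounded_linear[of B]]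
    by (auto simp: mult.commute)
  have "(\<lambda>k. \<Sum>i\<in>UNIV. \<Sum>j\<in>UNIV. \<bar>(A k - B) $ i $ j\<bar>)
      \<longlonglongrightarrow> (\<Sum>i\<in>UNIV. \<Sum>j\<in>UNIV. \<bar>(B - B) $ i $ j\<bar>)"
    by (intro tendsto_intros A)
  hence "\<forall>\<^sub>F k in sequentially. (\<Sum>i\<in>UNIV. \<Sum>j\<in>UNIV. \<bar>(A k - B) $ i $ j\<bar>) < e / 2"
    using e(1) by (intro order_tendstoD(2)) auto
  hence "\<forall>\<^sub>F k in sequentially. \<forall>f\<in>F. e / 2 * norm f \<le> norm (A k *v f)"
  proof (rule eventually_mono, intro ballI)
    fix k f
    assume small: "(\<Sum>i\<in>UNIV. \<Sum>j\<in>UNIV. \<bar>(A k - B) $ i $ j\<bar>) < e / 2" and f: "f \<in> F"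
    have "norm ((A k - B) *v f) \<le> onorm ((*v) (A k - B)) * norm f"
      by (rule onorm[OF matrix_vector_mul_bounded_linear])
    also have "\<dots> \<le> e / 2 * norm f"
      using small onorm_le_matrix_component_sum[of "A k - B"] by (intro mult_right_mono) auto
    finally have "norm (A k *v f - B *v f) \<le> e / 2 * norm f"
      by (simp add: matrix_vector_mult_diff_rdistrib)
    moreover have "e * norm f \<le> norm (B *v f)"
      using e f by blast
    moreover have "norm (B *v f) \<le> norm (A k *v f) + norm (A k *v f - B *v f)"
      using norm_triangle_sub[of "B *v f" "A k *v f"] by (simp add: norm_minus_commute)
    ultimately show "e / 2 * norm f \<le> norm (A k *v f)"
      by argo
  qed
  with e(1) show thesis
    using that[of "e / 2"] by simp
qed

text \<open>Constant rank is what makes every \<open>d \<in> E \<inter> ker B\<close> a limit of elements of \<open>E \<inter> ker (A k)\<close>,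
  and orthogonality to the latter then passes to the limit. On \<open>F = restricted_row_space E B\<close>
  the matrix \<open>A k\<close> is eventually injective, so by the rank assumption \<open>A k F = A k E\<close>; hence
  \<open>d\<close> can be corrected into the kernel of \<open>A k\<close> by some \<open>f k \<in> F\<close>, and \<open>f k\<close> is small because
  \<open>A k *v f k = A k *v d\<close> is.\<close>

lemma restricted_row_space_limit:
  fixes A :: "nat \<Rightarrow> real^'n^'m"
  assumes E: "subspace E" and A: "A \<longlonglongrightarrow> B"
    and rank: "\<forall>\<^sub>F k in sequentially. dim ((*v) (A k) ` E) = dim ((*v) B ` E)"
    and w: "\<And>k. w k \<in> restricted_row_space E (A k)" and w0: "w \<longlonglongrightarrow> w0"
  shows "w0 \<in> restricted_row_space E B"
  unfolding restricted_row_space_iff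
proof (intro conjI ballI impI)
  show "w0 \<in> E"
    using closed_sequentially[OF closed_subspace[OF E] _ w0] w by (simp add: restricted_row_space_iff)
  fix d assume d: "d \<in> E" "B *v d = 0"
  let ?F = "restricted_row_space E B"
  have F: "subspace ?F" and FE: "?F \<subseteq> E"
    using subspace_restricted_row_space[OF E] by (auto simp: restricted_row_space_def)
  have dim_image: "dim ((*v) M ` ?F) = dim ?F" if "inj_on ((*v) M) ?F" for M :: "real^'n^'m"
    using that by (intro dim_image_eq) (simp_all add: F span_eq_iff[THEN iffD2])
  have dimF: "dim ?F = dim ((*v) B ` E)"
    using dim_image[OF inj_on_restricted_row_space[OF E]] image_restricted_row_space[OF E, of B]
    by simp
  obtain c where c: "0 < c" and ge: "\<forall>\<^sub>F k in sequentially. \<forall>f\<in>?F. c * norm f \<le> norm (A k *v f)"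
    using eventually_norm_mult_ge[OF F inj_on_restricted_row_space[OF E] A] .
  have "\<forall>\<^sub>F k in sequentially. \<exists>f\<in>E. A k *v (d - f) = 0 \<and> norm f \<le> norm (A k *v d) / c"
    using rank ge
  proof eventually_elim
    case (elim k)
    have "inj_on ((*v) (A k)) ?F"
    proof (rule inj_onI)
      fix x y assume xy: "x \<in> ?F" "y \<in> ?F" "A k *v x = A k *v y"
      have "c * norm (x - y) \<le> norm (A k *v (x - y))"
        using elim(2) subspace_diff[OF F xy(1,2)] by blast
      also have "\<dots> = 0"
        using xy(3) by (simp add: matrix_vector_mult_diff_distrib)
      finally show "x = y"
        using c by (simp add: mult_le_0_iff)
    qed
    hence "dim ((*v) (A k) ` ?F) = dim ((*v) (A k) ` E)"
      using dim_image dimF elim(1) by simp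
    hence "(*v) (A k) ` ?F = (*v) (A k) ` E"
      using FE by (intro subspace_dim_equal linear_subspace_image matrix_vector_mul_linear F E) auto
    with d(1) obtain f where f: "f \<in> ?F" "A k *v d = A k *v f"
      by (metis imageE imageI)
    have "c * norm f \<le> norm (A k *v d)"
      using elim(2) f by auto
    hence "norm f \<le> norm (A k *v d) / c"
      using c by (simp add: field_simps)
    with f FE show ?case
      by (auto simp: matrix_vector_mult_diff_distrib)
  qed
  then obtain f where f: "\<forall>\<^sub>F k in sequentially.
      f k \<in> E \<and> A k *v (d - f k) = 0 \<and> norm (f k) \<le> norm (A k *v d) / c"
    unfolding eventually_sequentially Bex_def by metis
  have "(\<lambda>k. norm (A k *v d) / c) \<longlonglongrightarrow> norm (B *v d) / c"
    using c by (intro tendsto_intros tendsto_matrix_vector_mult A) auto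
  hence "f \<longlonglongrightarrow> 0"
    using f d(2) by (intro Lim_null_comparison[of f "\<lambda>k. norm (A k *v d) / c"])
      (auto elim: eventually_mono)
  hence "(\<lambda>k. w k \<bullet> (d - f k)) \<longlonglongrightarrow> w0 \<bullet> (d - 0)"
    by (intro tendsto_intros w0)
  moreover have "\<forall>\<^sub>F k in sequentially. w k \<bullet> (d - f k) = 0"
    using f
  proof eventually_elim
    case (elim k)
    with w[of k] d(1) E show ?case
      by (simp add: restricted_row_space_iff subspace_diff)
  qed
  hence "(\<lambda>k. w k \<bullet> (d - f k)) \<longlonglongrightarrow> 0"
    by (rule tendsto_eventually)
  ultimately show "w0 \<bullet> d = 0"
    using LIMSEQ_unique by fastforce
qed

section \<open>Normal and tangent cones\<close>

lemma cone_normal_cone: "cone (normal_cone S z)"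
  by (auto simp: cone_def normal_cone_def mult_nonneg_nonpos)

lemma normal_cone_limit:
  assumes x: "x \<longlonglongrightarrow> x0" "x0 \<in> S" and v: "\<And>k. v k \<in> normal_cone S (x k)" "v \<longlonglongrightarrow> v0"
  shows "v0 \<in> normal_cone S x0"
proof -
  have "v0 \<bullet> (y - x0) \<le> 0" if "y \<in> S" for y
  proof (rule LIMSEQ_le_const2)
    show "(\<lambda>k. v k \<bullet> (y - x k)) \<longlonglongrightarrow> v0 \<bullet> (y - x0)"
      by (intro tendsto_intros x v)
    show "\<exists>N. \<forall>k\<ge>N. v k \<bullet> (y - x k) \<le> 0"
      using v(1) that unfolding normal_cone_def by (metis (mono_tags, lifting) empty_iff mem_Collect_eq)
  qed
  with x(2) show ?thesis
    by (simp add: normal_cone_def)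
qed

lemma normal_cone_plus_orthogonal_comp:
  assumes v: "v \<in> normal_cone S z" and u: "u \<in> E\<^sup>\<bottom>" and E: "\<And>y. y \<in> S \<Longrightarrow> y - z \<in> E"
  shows "v + u \<in> normal_cone S z"
proof -
  have "u \<bullet> (y - z) = 0" if "y \<in> S" for y
    using u E[OF that] by (auto simp: orthogonal_comp_def orthogonal_def inner_commute[of u])
  with v show ?thesis
    by (auto simp: normal_cone_def inner_add_left split: if_splits)
qed

lemma normal_cone_inner_tangent_cone:
  assumes v: "v \<in> normal_cone S y" and d: "d \<in> tangent_cone S y"
  shows "v \<bullet> d \<le> 0"
proof -
  obtain u t where u: "\<And>k. u k \<in> S" "\<And>k. 0 < t k" and lim: "(\<lambda>k. (u k - y) /\<^sub>R t k) \<longlonglongrightarrow> d"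
    using d by (auto simp: tangent_cone_def)
  have "v \<bullet> ((u k - y) /\<^sub>R t k) \<le> 0" for k
    using v u(1)[of k] u(2)[of k] by (auto simp: normal_cone_def mult_nonneg_nonpos split: if_splits)
  thus ?thesis
    using LIMSEQ_le_const2[OF tendsto_inner[OF tendsto_const lim, of v], of 0] by blast
qed

lemma normal_cone_orthogonal_lin_tangent:
  assumes "v \<in> normal_cone S y" "d \<in> lin_tangent S y"
  shows "v \<bullet> d = 0"
proof (rule antisym)
  have "d \<in> tangent_cone S y" "- d \<in> tangent_cone S y"
    using assms(2) by (auto simp: lin_tangent_def)
  thus "v \<bullet> d \<le> 0" "0 \<le> v \<bullet> d"
    using normal_cone_inner_tangent_cone[OF assms(1)] by force+
qed

lemma tangent_cone_subset:
  assumes E: "subspace E" "\<And>x. x \<in> S \<Longrightarrow> x - y \<in> E"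
  shows "tangent_cone S y \<subseteq> E"
proof
  fix d assume "d \<in> tangent_cone S y"
  then obtain u t where u: "\<And>k. u k \<in> S" and lim: "(\<lambda>k. (u k - y) /\<^sub>R t k) \<longlonglongrightarrow> d"
    by (auto simp: tangent_cone_def)
  show "d \<in> E"
    using closed_subspace[OF E(1)] _ lim
    by (rule closed_sequentially) (use E u in \<open>auto intro: subspace_scale\<close>)
qed

text \<open>By the rank assumption some \<open>d\<close> in the span of the lineality space has \<open>A *v d = A *v w\<close>.
  Then \<open>w\<close> is orthogonal to \<open>w - d \<in> E \<inter> ker A\<close> and, as a normal, to \<open>d\<close>; hence to itself.
  The span occurs because \<open>dim\<close> of a set is the dimension of its span.\<close>

lemma restricted_row_space_Int_normal_cone:
  fixes A :: "real^'n^'m"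
  assumes E: "subspace E" "\<And>x. x \<in> S \<Longrightarrow> x - y \<in> E"
    and rank: "dim ((*v) A ` lin_tangent S y) = dim ((*v) A ` E)"
    and w: "w \<in> restricted_row_space E A" "- w \<in> normal_cone S y"
  shows "w = 0"
proof -
  let ?L = "lin_tangent S y"
  have LE: "?L \<subseteq> E"
    using tangent_cone_subset[OF E] by (auto simp: lin_tangent_def)
  have AE: "subspace ((*v) A ` E)"
    by (intro linear_subspace_image matrix_vector_mul_linear E)
  have "span ((*v) A ` ?L) = (*v) A ` E"
    using LE AE rank by (intro subspace_dim_equal subspace_span span_minimal) (auto simp: dim_span)
  hence span: "(*v) A ` span ?L = (*v) A ` E"
    using linear_span_image[OF matrix_vector_mul_linear, of A ?L] by simp
  have wE: "w \<in> E"
    using w(1) by (simp add: restricted_row_space_iff)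
  then obtain d where d: "d \<in> span ?L" "A *v w = A *v d"
    using span by (metis imageE imageI)
  have "orthogonal w d"
  proof (rule orthogonal_to_span[OF d(1)])
    fix x assume "x \<in> ?L"
    with w(2) show "orthogonal w x"
      using normal_cone_orthogonal_lin_tangent by (fastforce simp: orthogonal_def)
  qed
  moreover have "d \<in> E"
    using d(1) span_minimal[OF LE E(1)] by blast
  hence "w \<bullet> (w - d) = 0"
    using w(1) wE d(2) E(1)
    by (simp add: restricted_row_space_iff subspace_diff matrix_vector_mult_diff_distrib)
  ultimately show "w = 0"
    by (simp add: orthogonal_def inner_diff_right)
qed

section \<open>AM-regularity\<close>

text \<open>For \<open>C = {0}\<close> the cone \<open>N\<^sub>C(G x - z)\<close> is the whole space as soon as it is nonempty, so only
  the range of the transposed Jacobian remains; it can be traded for the restricted row space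
  because \<open>N\<^sub>D(x)\<close> absorbs \<open>E\<^sup>\<bottom>\<close>.\<close>

lemma AM_map_zero_eq:
  fixes G :: "real^'n \<Rightarrow> real^'m"
  assumes E: "subspace E" "\<And>y. y \<in> D \<Longrightarrow> y - x \<in> E" and Gx: "G x = z"
  shows "AM_map G {0} D x z = restricted_row_space E (Jac G x) + normal_cone D x"
proof -
  let ?N = "normal_cone D x" and ?R = "range ((*v) (transpose (Jac G x)))"
  have absorb: "E\<^sup>\<bottom> + ?N = ?N"
  proof
    have "v + u \<in> ?N" if "v \<in> ?N" "u \<in> E\<^sup>\<bottom>" for v u
      using that E(2) by (rule normal_cone_plus_orthogonal_comp)
    thus "E\<^sup>\<bottom> + ?N \<subseteq> ?N"
      by (metis add.commute set_plus_elim subsetI)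
    show "?N \<subseteq> E\<^sup>\<bottom> + ?N"
      by (rule set_zero_plus2) (rule subspace_0[OF subspace_orthogonal_comp])
  qed
  have "AM_map G {0} D x z = ?R + ?N"
    using Gx by (auto simp: AM_map_def normal_cone_def[of "{0}"] set_plus_def)
  also have "\<dots> = (?R + E\<^sup>\<bottom>) + ?N"
    by (simp add: add.assoc absorb)
  also have "\<dots> = (restricted_row_space E (Jac G x) + E\<^sup>\<bottom>) + ?N"
    by (simp add: restricted_row_space_plus_orthogonal_comp[OF E(1)])
  also have "\<dots> = restricted_row_space E (Jac G x) + ?N"
    by (simp add: add.assoc absorb)
  finally show ?thesis .
qed

theorem lemma2p15:
  fixes G :: "real^'n \<Rightarrow> real^'m"
    and D :: "(real^'n) set"
    and xbar :: "real^'n"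
  assumes "continuously_differentiable G"
    and "D \<noteq> {}" and "closed D" and "convex D"
    and "xbar \<in> D" and "G xbar = 0"
    and "\<exists>(r::nat) (\<tau>::real). 0 < r \<and> 0 < \<tau> \<and>
           (\<forall>y \<in> affine hull D. norm (y - xbar) \<le> \<tau> \<longrightarrow>
              dim ((\<lambda>d. Jac G y *v d) ` ((\<lambda>y. y - xbar) ` (affine hull D))) = r) \<and>
           (\<forall>y \<in> D. norm (y - xbar) \<le> \<tau> \<longrightarrow>
              dim ((\<lambda>d. Jac G y *v d) ` lin_tangent D y) = r)"
  shows "AM_regular G {0} D xbar"
proof -
  define E where "E = (\<lambda>y. y - xbar) ` (affine hull D)"
  have E: "subspace E"
    unfolding E_def using \<open>xbar \<in> D\<close>
    by (intro affine_diffs_subspace_subtract affine_affine_hull hull_inc)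
  have DE: "y - x \<in> E" if "y \<in> D" "x \<in> D" for x y
  proof -
    have "(y - xbar) - (x - xbar) \<in> E"
      by (rule subspace_diff[OF E]) (use that in \<open>auto simp: E_def hull_inc\<close>)
    thus ?thesis
      by simp
  qed
  obtain r \<tau> where \<tau>: "0 < \<tau>"
    and rankE: "\<And>y. y \<in> D \<Longrightarrow> norm (y - xbar) \<le> \<tau> \<Longrightarrow> dim ((*v) (Jac G y) ` E) = r"
    and rankL: "dim ((*v) (Jac G xbar) ` lin_tangent D xbar) = r"
    using assms(5,7) unfolding E_def by (force simp: hull_inc)
  have rank_xbar: "dim ((*v) (Jac G xbar) ` E) = r"
    using rankE[of xbar] \<tau> \<open>xbar \<in> D\<close> by simp
  have AM_xbar: "AM_map G {0} D xbar 0 = restricted_row_space E (Jac G xbar) + normal_cone D xbar"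
    using DE assms(5,6) by (intro AM_map_zero_eq E) auto
  have "\<xi> \<in> AM_map G {0} D xbar 0" if \<xi>: "\<xi> \<in> outer_limit (AM_map G {0} D) xbar 0" for \<xi>
  proof -
    obtain x z s where x: "x \<longlonglongrightarrow> xbar" and s: "\<And>k. s k \<in> AM_map G {0} D (x k) (z k)"
      and lim: "s \<longlonglongrightarrow> \<xi>"
      using \<xi> by (auto simp: outer_limit_def)
    have xD: "x k \<in> D" and Gx: "G (x k) = z k" for k
      using s[of k] by (auto simp: AM_map_def normal_cone_def split: if_splits)
    have "s k \<in> restricted_row_space E (Jac G (x k)) + normal_cone D (x k)" for k
      using s[of k] AM_map_zero_eq[of E D "x k" G "z k", OF E DE[OF _ xD] Gx] by blast
    hence "\<exists>w v. w \<in> restricted_row_space E (Jac G (x k)) \<and> v \<in> normal_cone D (x k) \<and> s k = w + v"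
      for k
      by (meson set_plus_elim)
    then obtain w v where w: "\<And>k. w k \<in> restricted_row_space E (Jac G (x k))"
      and v: "\<And>k. v k \<in> normal_cone D (x k)" and swv: "\<And>k. s k = w k + v k"
      by metis
    have "continuous_on UNIV (Jac G)"
      using assms(1) by (simp add: continuously_differentiable_def)
    hence Jac_lim: "(\<lambda>k. Jac G (x k)) \<longlonglongrightarrow> Jac G xbar"
      using x by (auto intro: continuous_on_tendsto_compose)
    have "\<forall>\<^sub>F k in sequentially. dist (x k) xbar < \<tau>"
      using x \<tau> by (rule tendstoD)
    hence rank_ev: "\<forall>\<^sub>F k in sequentially.
        dim ((*v) (Jac G (x k)) ` E) = dim ((*v) (Jac G xbar) ` E)"
      by eventually_elim (simp add: rankE[OF xD] rank_xbar dist_norm)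
    obtain w0 v0 where "w0 \<in> restricted_row_space E (Jac G xbar)" "v0 \<in> normal_cone D xbar"
      "\<xi> = w0 + v0"
    proof (rule limit_of_sum_of_transversal_cones[where w = w and v = v
          and W = "\<lambda>k. restricted_row_space E (Jac G (x k))" and N = "\<lambda>k. normal_cone D (x k)"
          and ?W0.0 = "restricted_row_space E (Jac G xbar)" and ?N0.0 = "normal_cone D xbar"
          and \<xi> = \<xi>])
      fix \<phi> :: "nat \<Rightarrow> nat" and u l
      assume \<phi>: "strict_mono \<phi>" and u: "\<And>k. u k \<in> restricted_row_space E (Jac G (x (\<phi> k)))"
        and l: "u \<longlonglongrightarrow> l"
      show "l \<in> restricted_row_space E (Jac G xbar)"
      proof (rule restricted_row_space_limit[OF E _ _ u l])
        show "(\<lambda>k. Jac G (x (\<phi> k))) \<longlonglongrightarrow> Jac G xbar"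
          using LIMSEQ_subseq_LIMSEQ[OF Jac_lim \<phi>] by (simp add: o_def)
        show "\<forall>\<^sub>F k in sequentially.
            dim ((*v) (Jac G (x (\<phi> k))) ` E) = dim ((*v) (Jac G xbar) ` E)"
          using eventually_subseq[OF \<phi> rank_ev] .
      qed
    next
      fix \<phi> :: "nat \<Rightarrow> nat" and u l
      assume \<phi>: "strict_mono \<phi>" and u: "\<And>k. u k \<in> normal_cone D (x (\<phi> k))" and l: "u \<longlonglongrightarrow> l"
      show "l \<in> normal_cone D xbar"
      proof (rule normal_cone_limit[OF _ assms(5) u l])
        show "(\<lambda>k. x (\<phi> k)) \<longlonglongrightarrow> xbar"
          using LIMSEQ_subseq_LIMSEQ[OF x \<phi>] by (simp add: o_def)
      qed
    next
      fix u assume "u \<in> restricted_row_space E (Jac G xbar)" "- u \<in> normal_cone D xbar"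
      thus "u = 0"
        using restricted_row_space_Int_normal_cone[of E D xbar "Jac G xbar" u, OF E DE[OF _ assms(5)]]
          rankL rank_xbar by simp
    next
      show "(\<lambda>k. w k + v k) \<longlonglongrightarrow> \<xi>"
        using lim by (simp add: swv[abs_def])
    qed (rule w v cone_normal_cone subspace_imp_cone subspace_restricted_row_space E that | assumption)+
    thus ?thesis
      unfolding AM_xbar by auto
  qed
  thus ?thesis
    using assms(5,6) by (auto simp: AM_regular_def)
qed

end
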